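(* Let $X$ be a nonempty compact metric space and let $V(t)$ be the multivalued semigroup determined by a generalized semiflow $G\subset C(\mathbb{R}_{\ge0},X)$ on $X$. Let $\mathcal{K}$ be the set of all continuous complete trajectories $\xi:\mathbb{R}\to X$ of $V$. Then $\mathcal{K}$ is nonempty and shift-invariant. Moreover, as a solution space on $\pi(\mathcal{K})$ (that is, with phase space $\pi(\mathcal{K})$, $\mathcal{K}\subset C(\mathbb{R},\pi(\mathcal{K}))$), $\mathcal{K}$ satisfies the existence, compactness, and switching axioms.
   Context: A generalized semiflow $G$ on $X$ is a family of maps $\phi:\mathbb{R}_{\ge0}\to X$ such that: (1) for each $z\in X$ there is at least one $\phi\in G$ with $\phi(0)=z$; (2) if $\phi\in G$ and $\tau\ge0$, then $\phi^\tau\in G$, where $\phi^\tau(t)=\phi(t+\tau)$; (3) if $\phi,\psi\in G$ and $\phi(t)=\psi(0)$ for some $t\ge 0$, then $\theta\in G$, where $\theta(s)=\phi(s)$ for $s\le t$ and $\theta(s)=\psi(s-t)$ for $s\ge t$; (4) if $\phi_j\in G$ with $\phi_j(0)\to z$, there exist a subsequence $\{\phi_\mu\}$ of $\{\phi_j\}$ and $\phi\in G$ with $\phi(0)=z$ and $\phi_\mu\to\phi$ pointwise. Here $G\subset C(\mathbb{R}_{\ge0},X)$ means that all members of $G$ are continuous. The multivalued semigroup determined by $G$: for $t\ge0$, $E\subset X$, $V(t)E=\{\phi(t) : \phi\in G,\ \phi(0)\in E\}$. A map $\xi:\mathbb{R}\to X$ is a complete trajectory if $\xi(t+s)\in V(t)\{\xi(s)\}$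 for all $t\ge0$, $s\in\mathbb{R}$. Let $\pi(\xi)=\xi(0)$. The space $C(\mathbb{R},Y)$ of continuous maps carries the compact-open topology (uniform convergence on compact sets). The shift is $\sigma(t,\xi)(s)=\xi(s+t)$; a set $S\subset C(\mathbb{R},Y)$ is shift-invariant if $\sigma(t,\xi)\in S$ for all $\xi\in S$, $t\in\mathbb{R}$. For such an $S$ with phase space $Y$: - existence axiom (on $Y$): for every $y\in Y$ there is $\xi\in S$ with $\xi(0)=y$ (equivalently, for every $(t,y)\in\mathbb{R}\times Y$ there is $\xi\in S$ with $\xi(t)=y$); - compactness axiom: for every compact $W\subset\mathbb{R}\times Y$ the set $\{(t,\xi)\in\mathbb{R}\times S : (t,\xi(t))\in W\}$ is compact; - switching axiom: whenever $\xi_1,\xi_2\in S$ and $\xi_1(\tau)=\xi_2(\tau)$ for some $\tau\in\mathbb{R}$, the map equal to $\xi_1(t)$ for $t\le\tau$ and to $\xi_2(t)$ for $t\ge\tau$ belongs to $S$. *)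

theory Defs
  imports "HOL-Analysis.Analysis"
begin

text \<open>
  Maps defined on the half-line \<open>{0..}\<close> are represented extensionally: they take the value
  \<^const>\<open>undefined\<close> at negative times, so that equality of such functions is equality of maps
  on \<open>{0..}\<close>.  The formula in \<open>concatenation\<close> respects this convention because its first
  branch covers all negative times.
\<close>

locale generalized_semiflow =
  fixes X :: "'a::metric_space set" and G :: "(real \<Rightarrow> 'a) set"
  assumes maps: "G \<subseteq> {0..} \<rightarrow>\<^sub>E X"
    and existence: "\<And>z. z \<in> X \<Longrightarrow> \<exists>\<phi>\<in>G. \<phi> 0 = z"
    and translation: "\<And>\<phi> \<tau>. \<lbrakk>\<phi> \<in> G; \<tau> \<ge> 0\<rbrakk> \<Longrightarrow> restrict (\<lambda>t. \<phi> (t + \<tau>)) {0..} \<in> G"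
    and concatenation: "\<And>\<phi> \<psi> t. \<lbrakk>\<phi> \<in> G; \<psi> \<in> G; t \<ge> 0; \<phi> t = \<psi> 0\<rbrakk>
      \<Longrightarrow> (\<lambda>s. if s \<le> t then \<phi> s else \<psi> (s - t)) \<in> G"
    and upper_semicontinuity: "\<And>(\<Phi> :: nat \<Rightarrow> real \<Rightarrow> 'a) z.
      \<lbrakk>\<And>j. \<Phi> j \<in> G; z \<in> X; (\<lambda>j. \<Phi> j 0) \<longlonglongrightarrow> z\<rbrakk>
      \<Longrightarrow> \<exists>r \<phi>. strict_mono r \<and> \<phi> \<in> G \<and> \<phi> 0 = z \<and> (\<forall>t\<ge>0. (\<lambda>j. \<Phi> (r j) t) \<longlonglongrightarrow> \<phi> t)"

definition multivalued_semigroup ::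
    "(real \<Rightarrow> 'a) set \<Rightarrow> real \<Rightarrow> 'a set \<Rightarrow> 'a set" where
  "multivalued_semigroup G t E = {\<phi> t | \<phi>. \<phi> \<in> G \<and> \<phi> 0 \<in> E}"

definition complete_trajectory ::
    "(real \<Rightarrow> 'a set \<Rightarrow> 'a set) \<Rightarrow> (real \<Rightarrow> 'a) \<Rightarrow> bool" where
  "complete_trajectory V \<xi> \<longleftrightarrow> (\<forall>t\<ge>0. \<forall>s. \<xi> (t + s) \<in> V t {\<xi> s})"

definition continuous_paths :: "'a::topological_space set \<Rightarrow> (real \<Rightarrow> 'a) set" where
  "continuous_paths Y = {\<xi>. continuous_on UNIV \<xi> \<and> range \<xi> \<subseteq> Y}"

definition compact_open_topology :: "'a::topological_space set \<Rightarrow> (real \<Rightarrow> 'a) topology" where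
  "compact_open_topology Y = topology_generated_by
     {{\<xi> \<in> continuous_paths Y. \<xi> ` C \<subseteq> U} | C U. compact C \<and> openin (top_of_set Y) U}"

lemma topspace_compact_open_topology [simp]:
  "topspace (compact_open_topology Y) = continuous_paths Y"
proof -
  have "continuous_paths Y \<in>
      {{\<xi> \<in> continuous_paths Y. \<xi> ` C \<subseteq> U} | C U. compact C \<and> openin (top_of_set Y) U}"
    by (rule CollectI, rule exI[of _ "{}"], rule exI[of _ "{}"]) auto
  then show ?thesis
    unfolding compact_open_topology_def topology_generated_by_topspace by blast
qed

definition continuous_complete_trajectories ::
    "'a::metric_space set \<Rightarrow> (real \<Rightarrow> 'a set \<Rightarrow> 'a set) \<Rightarrow> (real \<Rightarrow> 'a) set" where
  "continuous_complete_trajectories X V = {\<xi> \<in> continuous_paths X. complete_trajectory V \<xi>}"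

definition time_zero :: "(real \<Rightarrow> 'a) \<Rightarrow> 'a" where
  "time_zero \<xi> = \<xi> 0"

definition shift :: "real \<Rightarrow> (real \<Rightarrow> 'a) \<Rightarrow> real \<Rightarrow> 'a" where
  "shift t \<xi> = (\<lambda>s. \<xi> (s + t))"

definition shift_invariant :: "(real \<Rightarrow> 'a) set \<Rightarrow> bool" where
  "shift_invariant S \<longleftrightarrow> (\<forall>\<xi>\<in>S. \<forall>t. shift t \<xi> \<in> S)"

definition existence_axiom :: "'a set \<Rightarrow> (real \<Rightarrow> 'a) set \<Rightarrow> bool" where
  "existence_axiom Y S \<longleftrightarrow> (\<forall>y\<in>Y. \<exists>\<xi>\<in>S. \<xi> 0 = y)"

definition compactness_axiom :: "'a::metric_space set \<Rightarrow> (real \<Rightarrow> 'a) set \<Rightarrow> bool" where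
  "compactness_axiom Y S \<longleftrightarrow>
    (\<forall>W. compact W \<and> W \<subseteq> UNIV \<times> Y \<longrightarrow>
      compactin (prod_topology euclideanreal (subtopology (compact_open_topology Y) S))
        {(t, \<xi>). \<xi> \<in> S \<and> (t, \<xi> t) \<in> W})"

definition switching_axiom :: "(real \<Rightarrow> 'a) set \<Rightarrow> bool" where
  "switching_axiom S \<longleftrightarrow>
    (\<forall>\<xi>\<^sub>1\<in>S. \<forall>\<xi>\<^sub>2\<in>S. \<forall>\<tau>. \<xi>\<^sub>1 \<tau> = \<xi>\<^sub>2 \<tau> \<longrightarrow> (\<lambda>t. if t \<le> \<tau> then \<xi>\<^sub>1 t else \<xi>\<^sub>2 t) \<in> S)"

end

theory Submission
  imports Defs "HOL-Library.Diagonal_Subsequence"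
begin

text \<open>
  The multivalued semigroup only relates the values of a complete trajectory at two times, with a
  witness in \<open>G\<close> that may change with the two times.  The first observation is that a
  continuous complete trajectory is nevertheless a single solution on every half-line
  \<open>{s..}\<close>: concatenating witnesses gives members of \<open>G\<close> that agree with it at
  finitely many prescribed times, so a limit supplied by upper semicontinuity agrees with it at all rational
  times, hence everywhere by continuity
  (\<open>complete_trajectory_forward_mem\<close>).  Therefore \<open>\<K>\<close> is the set of maps on the
  whole line all of whose forward restrictions belong to \<open>G\<close>, and shift invariance, the
  switching axiom and the existence axiom on the set of values become direct consequences of the
  axioms for \<open>G\<close>.

  Since \<open>X\<close> is compact, upper semicontinuity and a diagonal argument over the half-lines
  \<open>{-m..}\<close> extract pointwise convergent subsequences with limit in \<open>\<K>\<close>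
  (\<open>pointwise_subsequence\<close>).  Applied to the translates of one solution, started ever
  earlier, this gives an element of \<open>\<K>\<close>.  Applied to sequences in \<open>\<K>\<close>, it
  gives sequential compactness, but only for pointwise convergence.

  The main point is to improve pointwise to locally uniform convergence
  (\<open>pointwise_imp_continuous_convergence\<close>), without any equicontinuity
  to start from.  If \<open>\<xi> n\<close> tends to \<open>\<xi>'\<close> pointwise and \<open>s n\<close>
  tends to \<open>s'\<close>, then along a subsequence the translates of \<open>\<xi> n\<close> by
  \<open>s n - s'\<close> converge pointwise to some \<open>\<zeta>\<close> in \<open>\<K>\<close>.  By the Baire
  category theorem the original convergence is locally uniform up to any given error near a dense
  set of times; there the vanishing translations are harmless, so \<open>\<zeta>\<close> and
  \<open>\<xi>'\<close> agree up to that error on a dense set, and by continuity they are equal.  At time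
  \<open>s'\<close> this says that \<open>\<xi> n (s n)\<close> tends to \<open>\<xi>' s'\<close>.

  Consequently \<open>\<K>\<close>, identified with its restrictions to rational times in a countable
  power of \<open>X\<close>, is a sequentially compact set in a metric space, and the map back to the
  compact-open topology is continuous.  So \<open>\<K>\<close> is compact, and the compactness
  axiom follows because evaluation \<open>(t, \<xi>) \<mapsto> \<xi> t\<close> is continuous for the compact-open
  topology.
\<close>

section \<open>Functions of a real variable\<close>

lemma continuous_eq_if_eq_on_Rats:
  fixes f g :: "real \<Rightarrow> 'a::metric_space"
  assumes f: "continuous_on {a..} f" and g: "continuous_on {a..} g"
    and eq: "\<And>q. q \<in> \<rat> \<Longrightarrow> a \<le> q \<Longrightarrow> f q = g q" and "a \<le> t"
  shows "f t = g t"
proof -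
  \<comment> \<open>Approaching from the right keeps the rational times inside the half-line, even if \<open>t = a\<close>.\<close>
  have "\<exists>q. q \<in> \<rat> \<and> t < q \<and> q < t + inverse (Suc n)" for n
    using Rats_dense_in_real[of t "t + inverse (Suc n)"] by auto
  then obtain q where q: "\<And>n. q n \<in> \<rat>" "\<And>n. t < q n" "\<And>n. q n < t + inverse (Suc n)"
    by metis
  have "(\<lambda>n. t + inverse (Suc n)) \<longlonglongrightarrow> t + 0"
    by (intro tendsto_intros LIMSEQ_inverse_real_of_nat)
  then have lim: "q \<longlonglongrightarrow> t"
    by (intro tendsto_sandwich[OF _ _ tendsto_const[of t], of q])
      (use q in \<open>auto intro!: always_eventually less_imp_le\<close>)
  have qa: "a \<le> q n" for n
    using q(2)[of n] \<open>a \<le> t\<close> by simp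
  have "(\<lambda>n. f (q n)) \<longlonglongrightarrow> f t" "(\<lambda>n. g (q n)) \<longlonglongrightarrow> g t"
    by (rule continuous_on_tendsto_compose[OF f lim] continuous_on_tendsto_compose[OF g lim];
        use qa \<open>a \<le> t\<close> in simp)+
  moreover have "f (q n) = g (q n)" for n
    using eq q(1) qa by blast
  ultimately show ?thesis
    by (simp add: LIMSEQ_unique)
qed

text \<open>
  The times at which all functions from index \<open>N\<close> on are within \<open>e\<close> of the limit form
  a closed set, and these sets exhaust a closed ball inside \<open>U\<close>; by the Baire category theorem
  one of them has an interior point.
\<close>

lemma locally_uniform_on_dense_set:
  fixes f :: "nat \<Rightarrow> real \<Rightarrow> 'a::metric_space"
  assumes cont: "\<And>n. continuous_on UNIV (f n)" "continuous_on UNIV g"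
    and lim: "\<And>t. (\<lambda>n. f n t) \<longlonglongrightarrow> g t"
    and U: "open U" "U \<noteq> {}" and e: "e > 0"
  obtains u B N where "u \<in> U" "open B" "u \<in> B" "\<And>n x. n \<ge> N \<Longrightarrow> x \<in> B \<Longrightarrow> dist (f n x) (g x) \<le> e"
proof -
  obtain a d where d: "d > 0" "cball a d \<subseteq> U"
    using U open_contains_cball by blast
  define F where "F N = {x \<in> cball a d. \<forall>n\<ge>N. dist (f n x) (g x) \<le> e}" for N
  have "F N = cball a d \<inter> (\<Inter>n\<in>{N..}. {x. dist (f n x) (g x) \<le> e})" for N
    unfolding F_def by auto
  moreover have "closed {x. dist (f n x) (g x) \<le> e}" for n
    by (intro closed_Collect_le continuous_intros cont)
  ultimately have closed: "closed (F N)" for N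
    by (simp add: closed_Int closed_INT)
  have "\<Union>(range F) = cball a d"
  proof -
    have "\<exists>N. \<forall>n\<ge>N. dist (f n x) (g x) \<le> e" for x
      using metric_LIMSEQ_D[OF lim[of x] e] by (auto intro: less_imp_le)
    then show ?thesis
      unfolding F_def by auto
  qed
  then have "euclidean interior_of \<Union>(range F) \<noteq> {}"
    using d(1) by simp
  moreover have "euclidean interior_of \<Union>(range F) = {}" if "\<And>N. interior (F N) = {}"
    by (rule Baire_category_alt)
      (use closed that in \<open>auto simp: completely_metrizable_space_euclidean\<close>)
  ultimately obtain N where "interior (F N) \<noteq> {}"
    by blast
  then obtain u where "u \<in> interior (F N)"
    by blast
  moreover have "x \<in> U" "\<And>n. n \<ge> N \<Longrightarrow> dist (f n x) (g x) \<le> e" if "x \<in> interior (F N)" for x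
    using d(2) subsetD[OF interior_subset that] by (auto simp: F_def)
  ultimately show thesis
    using that[of u "interior (F N)" N] by simp
qed

lemma tendsto_fun_componentwise:
  fixes f :: "'c \<Rightarrow> 'i \<Rightarrow> 'a::topological_space"
  shows "(f \<longlongrightarrow> l) F \<longleftrightarrow> (\<forall>i. ((\<lambda>c. f c i) \<longlongrightarrow> l i) F)"
  using limitin_componentwise[of "\<lambda>_. euclidean" UNIV f l F]
  by (simp add: euclidean_product_topology)

section \<open>Trajectories that are solutions on every half-line\<close>

text \<open>
  Restricted to \<open>{0..}\<close>, because members of a generalized semiflow are extensional maps
  on that half-line.
\<close>

definition forward :: "real \<Rightarrow> (real \<Rightarrow> 'a) \<Rightarrow> real \<Rightarrow> 'a" where
  "forward s \<xi> = restrict (\<lambda>t. \<xi> (t + s)) {0..}"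

lemma forward_apply [simp]: "0 \<le> t \<Longrightarrow> forward s \<xi> t = \<xi> (t + s)"
  by (simp add: forward_def)

lemma forward_forward: "0 \<le> t \<Longrightarrow> forward t (forward s \<xi>) = forward (t + s) \<xi>"
  by (auto simp: forward_def fun_eq_iff restrict_def add.assoc)

lemma forward_shift: "forward s (shift t \<xi>) = forward (s + t) \<xi>"
  by (simp add: forward_def shift_def add.assoc)

definition full_trajectories :: "(real \<Rightarrow> 'a) set \<Rightarrow> (real \<Rightarrow> 'a) set" where
  "full_trajectories G = {\<xi>. \<forall>s. forward s \<xi> \<in> G}"

lemma shift_full_trajectory: "\<xi> \<in> full_trajectories G \<Longrightarrow> shift t \<xi> \<in> full_trajectories G"
  by (simp add: full_trajectories_def forward_shift)

locale compact_continuous_semiflow = generalized_semiflow +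
  assumes compact_space: "compact X"
    and continuous: "\<And>\<phi>. \<phi> \<in> G \<Longrightarrow> continuous_on {0..} \<phi>"
begin

lemma forward_mem: "\<phi> \<in> G \<Longrightarrow> 0 \<le> \<tau> \<Longrightarrow> forward \<tau> \<phi> \<in> G"
  using translation by (simp add: forward_def)

lemma in_space: "\<phi> \<in> G \<Longrightarrow> 0 \<le> t \<Longrightarrow> \<phi> t \<in> X"
  using maps by (auto dest: subsetD)

text \<open>
  Compactness of the phase space makes the initial values converge along a subsequence, so
  upper semicontinuity applies to every sequence of solutions.
\<close>

lemma trajectory_subsequence:
  fixes \<Phi> :: "nat \<Rightarrow> real \<Rightarrow> 'a"
  assumes "\<And>j. \<Phi> j \<in> G"
  obtains r \<phi> where "strict_mono r" "\<phi> \<in> G" "\<And>t. 0 \<le> t \<Longrightarrow> (\<lambda>j. \<Phi> (r j) t) \<longlonglongrightarrow> \<phi> t"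
proof -
  have "\<forall>j. \<Phi> j 0 \<in> X"
    using assms in_space by simp
  then obtain z r where z: "z \<in> X" "strict_mono (r :: nat \<Rightarrow> nat)" "((\<lambda>j. \<Phi> j 0) \<circ> r) \<longlonglongrightarrow> z"
    using seq_compactE[OF compact_imp_seq_compact[OF compact_space], of "\<lambda>j. \<Phi> j 0"] by blast
  obtain r' \<phi> where "strict_mono r'" "\<phi> \<in> G" "\<forall>t\<ge>0. (\<lambda>j. \<Phi> (r (r' j)) t) \<longlonglongrightarrow> \<phi> t"
    using upper_semicontinuity[of "\<lambda>j. \<Phi> (r j)" z] assms z by (auto simp: o_def)
  then show thesis
    using that[of "r \<circ> r'" \<phi>] strict_mono_o z(2) by auto
qed

lemma full_trajectory_continuous:
  assumes "\<xi> \<in> full_trajectories G" shows "continuous_on UNIV \<xi>"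
proof -
  have "isCont \<xi> t" for t
  proof -
    \<comment> \<open>Starting one time unit earlier makes \<open>t\<close> an interior point of the half-line.\<close>
    have "continuous_on {0..} (forward (t - 1) \<xi>)"
      using assms continuous by (simp add: full_trajectories_def)
    then have "continuous_on {0..} (\<lambda>u. \<xi> (u + (t - 1)))"
      by (rule continuous_on_cong[THEN iffD1, rotated 2]) auto
    then have "continuous_on {0<..} (\<lambda>u. \<xi> (u + (t - 1)))"
      by (rule continuous_on_subset) auto
    then have "isCont (\<lambda>u. \<xi> (u + (t - 1))) 1"
      by (simp add: continuous_on_eq_continuous_at)
    then show "isCont \<xi> t"
      using isCont_o2[where f = "\<lambda>v. v - (t - 1)" and a = t and g = "\<lambda>u. \<xi> (u + (t - 1))"]
      by simp
  qed
  then show ?thesis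
    by (simp add: continuous_at_imp_continuous_on)
qed

lemma full_trajectory_in_space: "\<xi> \<in> full_trajectories G \<Longrightarrow> \<xi> t \<in> X"
  using in_space[of "forward t \<xi>" 0] by (simp add: full_trajectories_def)

text \<open>
  The \<open>n\<close>-th map is required to be a solution only from time \<open>-n\<close> on.  This covers
  both uses: sequences of full trajectories, and translates of a solution on \<open>{0..}\<close>, whose
  domains grow to the whole line.  The subsequence chosen for the half-line
  \<open>{-m..}\<close> is refined in passing to \<open>m + 1\<close>, and the diagonal one converges on all of
  them; the limits on the half-lines are then restrictions of one map.
\<close>

lemma pointwise_subsequence:
  fixes \<eta> :: "nat \<Rightarrow> real \<Rightarrow> 'a"
  assumes \<eta>: "\<And>m n. m \<le> n \<Longrightarrow> forward (- real m) (\<eta> n) \<in> G"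
  obtains r \<xi> where "strict_mono r" "\<xi> \<in> full_trajectories G" "\<And>t. (\<lambda>j. \<eta> (r j) t) \<longlonglongrightarrow> \<xi> t"
proof -
  define P where "P m r \<longleftrightarrow>
    (\<exists>\<phi>\<in>G. \<forall>t\<ge>0. (\<lambda>j. \<eta> (r j) (t - real m)) \<longlonglongrightarrow> \<phi> t)" for m and r :: "nat \<Rightarrow> nat"
  interpret subseqs P
  proof
    fix m and s :: "nat \<Rightarrow> nat" assume s: "strict_mono s"
    \<comment> \<open>The first \<open>m\<close> terms are dropped, since they may not be solutions from time \<open>-m\<close>.\<close>
    have "m \<le> s (j + m)" for j
      using seq_suble[OF s, of "j + m"] by simp
    then obtain r \<phi> where r: "strict_mono r" "\<phi> \<in> G"
      "\<And>t. 0 \<le> t \<Longrightarrow> (\<lambda>j. forward (- real m) (\<eta> (s (r j + m))) t) \<longlonglongrightarrow> \<phi> t"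
      using trajectory_subsequence[of "\<lambda>j. forward (- real m) (\<eta> (s (j + m)))"] \<eta> by blast
    have "strict_mono (\<lambda>j. r j + m)"
      using r(1) by (simp add: strict_mono_def)
    moreover have "P m (s \<circ> (\<lambda>j. r j + m))"
      unfolding P_def using r(2,3) by (auto intro!: bexI[of _ \<phi>])
    ultimately show "\<exists>r'. strict_mono r' \<and> P m (s \<circ> r')"
      by blast
  qed
  have "P m (diagseq \<circ> (+) (Suc m))" for m
  proof (rule diagseq_holds)
    fix r s :: "nat \<Rightarrow> nat" and n assume r: "strict_mono r" and "P n s"
    then obtain \<phi> where "\<phi> \<in> G" "\<forall>t\<ge>0. (\<lambda>j. \<eta> (s j) (t - real n)) \<longlonglongrightarrow> \<phi> t"
      unfolding P_def by blast
    then show "P n (s \<circ> r)"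
      unfolding P_def using LIMSEQ_subseq_LIMSEQ[OF _ r]
      by (intro bexI[of _ \<phi>]) (auto simp: o_def)
  qed
  moreover have "P m s \<Longrightarrow> \<exists>\<phi>\<in>G. \<forall>t\<ge>0. (\<lambda>j. \<eta> (s j) (t - real m)) \<longlonglongrightarrow> \<phi> t" for m s
    by (simp add: P_def)
  ultimately have "\<exists>\<phi>\<in>G. \<forall>t\<ge>0. (\<lambda>j. \<eta> (diagseq (j + Suc m)) (t - real m)) \<longlonglongrightarrow> \<phi> t" for m
    by (fastforce simp: add.commute)
  then have "\<exists>\<phi>\<in>G. \<forall>t\<ge>0. (\<lambda>j. \<eta> (diagseq j) (t - real m)) \<longlonglongrightarrow> \<phi> t" for m
    using LIMSEQ_offset[of "\<lambda>j. \<eta> (diagseq j) _"] by blast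
  then obtain \<psi> where \<psi>: "\<And>m. \<psi> m \<in> G"
    "\<And>m t. 0 \<le> t \<Longrightarrow> (\<lambda>j. \<eta> (diagseq j) (t - real m)) \<longlonglongrightarrow> \<psi> m t"
    by metis
  define \<xi> where "\<xi> t = lim (\<lambda>j. \<eta> (diagseq j) t)" for t
  have eq: "\<xi> (t - real m) = \<psi> m t" if "0 \<le> t" for m t
    unfolding \<xi>_def using \<psi>(2)[OF that] by (rule limI)
  have lim: "(\<lambda>j. \<eta> (diagseq j) t) \<longlonglongrightarrow> \<xi> t" for t
  proof -
    obtain m where "- t \<le> real m"
      using real_arch_simple by blast
    then show ?thesis
      using \<psi>(2)[of "t + real m" m] eq[of "t + real m" m] by simp
  qed
  have base: "forward (- real m) \<xi> = \<psi> m" for m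
  proof
    fix t show "forward (- real m) \<xi> t = \<psi> m t"
      using eq[of t m] maps \<psi>(1)[of m] by (cases "0 \<le> t") (auto simp: forward_def PiE_def extensional_def)
  qed
  have "forward s \<xi> \<in> G" for s
  proof -
    obtain m where "- s \<le> real m"
      using real_arch_simple by blast
    then show ?thesis
      using forward_mem[OF \<psi>(1)[of m], of "s + real m"]
      by (simp add: base[symmetric] forward_forward)
  qed
  then show thesis
    using that[OF subseq_diagseq _ lim] by (simp add: full_trajectories_def)
qed

corollary full_trajectory_subsequence:
  fixes \<eta> :: "nat \<Rightarrow> real \<Rightarrow> 'a"
  assumes "\<And>n. \<eta> n \<in> full_trajectories G"
  obtains r \<xi> where "strict_mono r" "\<xi> \<in> full_trajectories G" "\<And>t. (\<lambda>j. \<eta> (r j) t) \<longlonglongrightarrow> \<xi> t"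
  using pointwise_subsequence[of \<eta> thesis] assms by (simp add: full_trajectories_def)

text \<open>
  A limit of the translates \<open>\<lambda>t. \<phi> (t + n)\<close> of any solution \<open>\<phi>\<close> has an infinite
  past.
\<close>

lemma full_trajectories_nonempty:
  assumes "X \<noteq> {}" shows "full_trajectories G \<noteq> {}"
proof -
  obtain \<phi> where \<phi>: "\<phi> \<in> G"
    using assms existence by blast
  have "forward (- real m) (\<lambda>t. \<phi> (t + real n)) \<in> G" if "m \<le> n" for m n
    using forward_mem[OF \<phi>, of "real n - real m"] that by (simp add: forward_def algebra_simps)
  then show ?thesis
    using pointwise_subsequence[of "\<lambda>n t. \<phi> (t + real n)"] by blast
qed

section \<open>From pointwise to locally uniform convergence\<close>

text \<open>
  Along subsequences, the translates of \<open>\<xi> n\<close> by the vanishing amounts \<open>s n - s'\<close> also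
  converge pointwise to a full trajectory.  Its values and those of \<open>\<xi>'\<close> agree up to any error
  on a dense set of times, where the convergence of \<open>\<xi> n\<close> is locally uniform up to that error,
  and hence the two are equal.
\<close>

lemma pointwise_imp_continuous_convergence:
  assumes \<xi>: "\<And>n. \<xi> n \<in> full_trajectories G" "\<xi>' \<in> full_trajectories G"
    and lim: "\<And>t. (\<lambda>n. \<xi> n t) \<longlonglongrightarrow> \<xi>' t" and s: "s \<longlonglongrightarrow> s'"
  shows "(\<lambda>n. \<xi> n (s n)) \<longlonglongrightarrow> \<xi>' s'"
proof (rule ccontr)
  assume "\<not> ?thesis"
  then obtain e where e: "e > 0" "\<not> (\<forall>\<^sub>F n in sequentially. dist (\<xi> n (s n)) (\<xi>' s') < e)"
    unfolding tendsto_iff by blast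
  obtain r :: "nat \<Rightarrow> nat" where r: "strict_mono r" "\<And>n. \<not> dist (\<xi> (r n) (s (r n))) (\<xi>' s') < e"
    using not_eventually_sequentiallyD[OF e(2)] by blast
  have "shift (s (r n) - s') (\<xi> (r n)) \<in> full_trajectories G" for n
    by (rule shift_full_trajectory[OF \<xi>(1)])
  then obtain r' \<zeta> where r': "strict_mono r'" and \<zeta>: "\<zeta> \<in> full_trajectories G"
    and lim\<zeta>: "\<And>t. (\<lambda>n. shift (s (r (r' n)) - s') (\<xi> (r (r' n))) t) \<longlonglongrightarrow> \<zeta> t"
    by (rule full_trajectory_subsequence[of "\<lambda>n. shift (s (r n) - s') (\<xi> (r n))"]) (rule that)
  define k where "k = r \<circ> r'"
  have k: "strict_mono k"
    unfolding k_def using r(1) r' by (rule strict_mono_o)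
  have lim\<zeta>: "(\<lambda>n. \<xi> (k n) (t + (s (k n) - s'))) \<longlonglongrightarrow> \<zeta> t" for t
    using lim\<zeta> by (simp add: shift_def k_def)
  have shifted: "(\<lambda>n. t + (s (k n) - s')) \<longlonglongrightarrow> t" for t
    using tendsto_add[OF tendsto_const[of t] tendsto_diff[OF LIMSEQ_subseq_LIMSEQ[OF s k] tendsto_const[of s']]]
    by (simp add: o_def)
  note cont = full_trajectory_continuous[OF \<xi>(1)] full_trajectory_continuous[OF \<xi>(2)]
    full_trajectory_continuous[OF \<zeta>]
  have "\<zeta> s' = \<xi>' s'"
  proof (rule ccontr)
    assume neq: "\<zeta> s' \<noteq> \<xi>' s'"
    \<comment> \<open>The set \<open>U\<close> of times with separation more than \<open>d\<close> is open and contains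
      \<open>s'\<close>, so it contains a time near which \<open>\<xi> n\<close> is eventually within \<open>d\<close>
      of its limit.\<close>
    define d where "d = dist (\<zeta> s') (\<xi>' s') / 2"
    define U where "U = {t. d < dist (\<zeta> t) (\<xi>' t)}"
    have "open U"
      unfolding U_def by (intro open_Collect_less continuous_intros cont)
    moreover have "s' \<in> U" "d > 0"
      using neq by (auto simp: U_def d_def)
    ultimately obtain u B N where u: "u \<in> U" "open B" "u \<in> B"
      and close: "\<And>n x. n \<ge> N \<Longrightarrow> x \<in> B \<Longrightarrow> dist (\<xi> n x) (\<xi>' x) \<le> d"
      using locally_uniform_on_dense_set[of \<xi> \<xi>' U d] cont lim by blast
    have "\<forall>\<^sub>F n in sequentially. u + (s (k n) - s') \<in> B"
      using shifted u(2,3) by (rule topological_tendstoD)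
    moreover have "\<forall>\<^sub>F n in sequentially. N \<le> k n"
      using k by (metis eventually_sequentiallyI le_trans seq_suble)
    ultimately have "\<forall>\<^sub>F n in sequentially.
        dist (\<xi> (k n) (u + (s (k n) - s'))) (\<xi>' (u + (s (k n) - s'))) \<le> d"
      by eventually_elim (rule close)
    moreover have "(\<lambda>n. \<xi>' (u + (s (k n) - s'))) \<longlonglongrightarrow> \<xi>' u"
      using cont(2) shifted[of u] by (auto intro: continuous_on_tendsto_compose)
    ultimately have "dist (\<zeta> u) (\<xi>' u) \<le> d"
      by (intro tendsto_le[OF _ tendsto_const tendsto_dist[OF lim\<zeta>]]) auto
    then show False
      using u(1) by (simp add: U_def)
  qed
  then have "(\<lambda>n. dist (\<xi> (k n) (s (k n))) (\<xi>' s')) \<longlonglongrightarrow> 0"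
    using tendsto_dist[OF lim\<zeta>[of s'] tendsto_const[of "\<xi>' s'"]] by simp
  then have "\<forall>\<^sub>F n in sequentially. dist (\<xi> (k n) (s (k n))) (\<xi>' s') < e"
    using e(1) by (rule order_tendstoD)
  then show False
    using r(2) by (auto simp: k_def eventually_sequentially)
qed

section \<open>Continuous complete trajectories of the multivalued semigroup\<close>

text \<open>
  Induction over the prescribed times in increasing order: the solution found so far is followed
  up to the last time already treated and then continued by a witness for one semigroup step.
\<close>

lemma complete_trajectory_interpolation:
  assumes \<xi>: "complete_trajectory (multivalued_semigroup G) \<xi>" "\<xi> s \<in> X" and "finite F" "F \<subseteq> {0..}"
  shows "\<exists>\<phi>\<in>G. \<forall>t\<in>F. \<phi> t = \<xi> (t + s)"
proof -
  have step: "\<exists>\<psi>\<in>G. \<psi> 0 = \<xi> a \<and> \<psi> t = \<xi> (t + a)" if "0 \<le> t" for t a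
    using \<xi> that unfolding complete_trajectory_def multivalued_semigroup_def by fastforce
  \<comment> \<open>Time \<open>0\<close> is added so that there is always a last treated time.\<close>
  have "\<exists>\<phi>\<in>G. \<forall>t\<in>insert 0 F. \<phi> t = \<xi> (t + s)"
    using \<open>finite F\<close> \<open>F \<subseteq> {0..}\<close>
  proof (induction F rule: finite_linorder_max_induct)
    case empty
    show ?case
      using existence[OF \<xi>(2)] by auto
  next
    case (insert b A)
    then obtain \<phi> where \<phi>: "\<phi> \<in> G" "\<forall>t\<in>Set.insert 0 A. \<phi> t = \<xi> (t + s)"
      by auto
    define a where "a = Max (Set.insert 0 A)"
    have a: "a \<in> Set.insert 0 A" "0 \<le> a" "a \<le> b" "\<And>t. t \<in> Set.insert 0 A \<Longrightarrow> t \<le> a"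
      unfolding a_def using insert Max_in[of "Set.insert 0 A"] by (auto intro: less_imp_le)
    obtain \<psi> where \<psi>: "\<psi> \<in> G" "\<psi> 0 = \<xi> (a + s)" "\<psi> (b - a) = \<xi> (b - a + (a + s))"
      using step[of "b - a" "a + s"] a by auto
    define \<theta> where "\<theta> t = (if t \<le> a then \<phi> t else \<psi> (t - a))" for t
    have "\<theta> \<in> G"
      unfolding \<theta>_def using a \<phi> \<psi> by (intro concatenation) auto
    moreover have "\<theta> t = \<xi> (t + s)" if "t \<in> Set.insert 0 A" for t
      using a(4)[OF that] bspec[OF \<phi>(2) that] by (simp add: \<theta>_def)
    moreover have "\<theta> b = \<xi> (b + s)"
      using a \<phi> \<psi> by (cases "b = a") (auto simp: \<theta>_def)
    ultimately show ?case
      by (intro bexI[of _ \<theta>]) auto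
  qed
  then show ?thesis
    by blast
qed

text \<open>
  Solutions interpolating at the first \<open>n\<close> rational times have a pointwise limit in
  \<open>G\<close> along a subsequence; it agrees with the trajectory at all rational times, and
  continuity of both maps gives agreement on the half-line.
\<close>

lemma complete_trajectory_forward_mem:
  assumes cont: "continuous_on UNIV \<xi>" and X: "\<And>t. \<xi> t \<in> X"
    and \<xi>: "complete_trajectory (multivalued_semigroup G) \<xi>"
  shows "forward s \<xi> \<in> G"
proof -
  define Q :: "real set" where "Q = \<rat> \<inter> {0..}"
  have "countable Q" "0 \<in> Q"
    unfolding Q_def using countable_rat by auto
  then obtain q :: "nat \<Rightarrow> real" where q: "range q = Q"
    using range_from_nat_into by (metis empty_iff)
  have "\<exists>\<phi>\<in>G. \<forall>t\<in>q ` {..<n}. \<phi> t = \<xi> (t + s)" for n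
    using q by (intro complete_trajectory_interpolation[OF \<xi> X]) (auto simp: Q_def)
  then obtain \<Phi> where \<Phi>: "\<And>n. \<Phi> n \<in> G" "\<And>n i. i < n \<Longrightarrow> \<Phi> n (q i) = \<xi> (q i + s)"
    by (metis imageI lessThan_iff)
  obtain r \<phi> where r: "strict_mono r" and \<phi>: "\<phi> \<in> G"
    and lim: "\<And>t. 0 \<le> t \<Longrightarrow> (\<lambda>n. \<Phi> (r n) t) \<longlonglongrightarrow> \<phi> t"
    using trajectory_subsequence[of \<Phi>] \<Phi>(1) by blast
  have "\<phi> t = \<xi> (t + s)" if "t \<in> \<rat>" "0 \<le> t" for t
  proof -
    have "t \<in> range q"
      using that by (simp add: q Q_def)
    then obtain i where i: "t = q i"
      by blast
    have "\<forall>\<^sub>F n in sequentially. \<Phi> (r n) t = \<xi> (t + s)"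
      using eventually_gt_at_top[of i]
      by eventually_elim (use \<Phi>(2) seq_suble[OF r] in \<open>auto simp: i dest: less_le_trans\<close>)
    then have "(\<lambda>n. \<Phi> (r n) t) \<longlonglongrightarrow> \<xi> (t + s)"
      by (rule tendsto_eventually)
    then show ?thesis
      using lim[OF that(2)] LIMSEQ_unique by blast
  qed
  moreover have "continuous_on {0..} (\<lambda>t. \<xi> (t + s))"
    by (rule continuous_on_compose2[OF cont]) (auto intro: continuous_intros)
  ultimately have eq: "\<phi> t = \<xi> (t + s)" if "0 \<le> t" for t
    using continuous_eq_if_eq_on_Rats[OF continuous[OF \<phi>], of "\<lambda>t. \<xi> (t + s)"] that by simp
  have "forward s \<xi> = \<phi>"
  proof
    fix t show "forward s \<xi> t = \<phi> t"
      using eq[of t] maps \<phi> by (cases "0 \<le> t") (auto simp: forward_def PiE_def extensional_def)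
  qed
  then show ?thesis
    using \<phi> by simp
qed

lemma continuous_complete_trajectories_eq:
  "continuous_complete_trajectories X (multivalued_semigroup G) = full_trajectories G"
proof (intro set_eqI iffI)
  fix \<xi> assume "\<xi> \<in> continuous_complete_trajectories X (multivalued_semigroup G)"
  then show "\<xi> \<in> full_trajectories G"
    by (auto simp: continuous_complete_trajectories_def continuous_paths_def full_trajectories_def
        intro!: complete_trajectory_forward_mem)
next
  fix \<xi> assume \<xi>: "\<xi> \<in> full_trajectories G"
  have "\<xi> (t + s) \<in> multivalued_semigroup G t {\<xi> s}" if "0 \<le> t" for t s
    unfolding multivalued_semigroup_def
    using \<xi> that by (auto intro!: exI[of _ "forward s \<xi>"] simp: full_trajectories_def)
  then show "\<xi> \<in> continuous_complete_trajectories X (multivalued_semigroup G)"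
    using full_trajectory_continuous[OF \<xi>] full_trajectory_in_space[OF \<xi>]
    by (auto simp: continuous_complete_trajectories_def continuous_paths_def complete_trajectory_def)
qed

text \<open>
  A half-line that starts before the switching time sees a concatenation of two members of
  \<open>G\<close>; one that starts later sees only the second trajectory.
\<close>

lemma full_trajectories_switching: "switching_axiom (full_trajectories G)"
  unfolding switching_axiom_def
proof (intro ballI allI impI)
  fix \<xi>\<^sub>1 \<xi>\<^sub>2 \<tau> assume \<xi>: "\<xi>\<^sub>1 \<in> full_trajectories G" "\<xi>\<^sub>2 \<in> full_trajectories G" "\<xi>\<^sub>1 \<tau> = \<xi>\<^sub>2 \<tau>"
  let ?\<theta> = "\<lambda>t. if t \<le> \<tau> then \<xi>\<^sub>1 t else \<xi>\<^sub>2 t"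
  have "forward s ?\<theta> \<in> G" for s
  proof (cases "s \<le> \<tau>")
    case True
    have "(\<lambda>t. if t \<le> \<tau> - s then forward s \<xi>\<^sub>1 t else forward \<tau> \<xi>\<^sub>2 (t - (\<tau> - s))) \<in> G"
      using \<xi> True by (intro concatenation) (auto simp: full_trajectories_def)
    also have "(\<lambda>t. if t \<le> \<tau> - s then forward s \<xi>\<^sub>1 t else forward \<tau> \<xi>\<^sub>2 (t - (\<tau> - s))) = forward s ?\<theta>"
      using True by (auto simp: forward_def fun_eq_iff restrict_def algebra_simps)
    finally show ?thesis .
  next
    case False
    then have "forward s ?\<theta> = forward s \<xi>\<^sub>2"
      by (auto simp: forward_def fun_eq_iff restrict_def)
    then show ?thesis
      using \<xi>(2) by (simp add: full_trajectories_def)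
  qed
  then show "?\<theta> \<in> full_trajectories G"
    by (simp add: full_trajectories_def)
qed

section \<open>Compactness in the compact-open topology\<close>

text \<open>
  Restriction to rational times embeds the set of full trajectories in the metric space of maps
  \<open>rat \<Rightarrow> 'a\<close>, where compactness can be checked with sequences.  The inverse of this embedding is
  continuous into the compact-open topology: if restrictions converge and the trajectories leave an
  open set at times in a compact set, then a limit of these times, together with
  \<open>pointwise_imp_continuous_convergence\<close>, shows that the limit trajectory leaves it too.
\<close>

lemma compactin_full_trajectories:
  assumes Y: "full_trajectories G \<subseteq> continuous_paths Y"
  shows "compactin (compact_open_topology Y) (full_trajectories G)"
proof -
  define e :: "(real \<Rightarrow> 'a) \<Rightarrow> rat \<Rightarrow> 'a" where "e \<xi> q = \<xi> (of_rat q)" for \<xi> q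
  define S where "S = e ` full_trajectories G"
  define g where "g = inv_into (full_trajectories G) e"
  have e_inj: "\<xi> = \<xi>'" if "\<xi> \<in> full_trajectories G" "\<xi>' \<in> full_trajectories G" "e \<xi> = e \<xi>'" for \<xi> \<xi>'
  proof
    fix t
    have "\<xi> q = \<xi>' q" if "q \<in> \<rat>" for q
      using that fun_cong[OF \<open>e \<xi> = e \<xi>'\<close>] unfolding e_def by (auto elim!: Rats_cases)
    moreover have "continuous_on {t..} \<xi>" "continuous_on {t..} \<xi>'"
      using full_trajectory_continuous[OF that(1)] full_trajectory_continuous[OF that(2)]
      by (auto intro: continuous_on_subset)
    ultimately show "\<xi> t = \<xi>' t"
      using continuous_eq_if_eq_on_Rats[of t \<xi> \<xi>' t] by simp
  qed
  have g_e [simp]: "g (e \<xi>) = \<xi>" if "\<xi> \<in> full_trajectories G" for \<xi>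
    unfolding g_def by (rule inv_into_f_f[OF inj_onI that]) (rule e_inj)
  have g: "g x \<in> full_trajectories G" "e (g x) = x" if "x \<in> S" for x
    using that by (auto simp: S_def)
  have g_paths: "g x \<in> continuous_paths Y" if "x \<in> S" for x
    using g(1)[OF that] Y by blast
  have g_Y: "g x t \<in> Y" if "x \<in> S" for x t
    using g_paths[OF that] by (auto simp: continuous_paths_def)
  have S: "seq_compact S"
    unfolding seq_compact_def
  proof (intro allI impI)
    fix x assume x: "\<forall>n::nat. x n \<in> S"
    then have "g (x n) \<in> full_trajectories G" for n
      using g(1) by simp
    then obtain r \<xi> where r: "strict_mono r" "\<xi> \<in> full_trajectories G"
      "\<And>t. (\<lambda>n. g (x (r n)) t) \<longlonglongrightarrow> \<xi> t"
      by (rule full_trajectory_subsequence[of "\<lambda>n. g (x n)"]) (rule that)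
    have "(\<lambda>n. e (g (x (r n)))) \<longlonglongrightarrow> e \<xi>"
      by (rule tendsto_fun_componentwise[THEN iffD2]) (use r(3) in \<open>auto simp: e_def\<close>)
    then have "(x \<circ> r) \<longlonglongrightarrow> e \<xi>"
      using g(2) x by (simp add: o_def)
    then show "\<exists>l\<in>S. \<exists>r. strict_mono r \<and> (x \<circ> r) \<longlonglongrightarrow> l"
      using r(1,2) by (auto simp: S_def)
  qed
  then have "compact S"
    using compact_eq_seq_compact_metric by blast
  have "continuous_map (top_of_set S) (compact_open_topology Y) g"
    unfolding compact_open_topology_def
  proof (rule continuous_on_generated_topo)
    fix B assume "B \<in> {{\<xi> \<in> continuous_paths Y. \<xi> ` C \<subseteq> U} | C U. compact C \<and> openin (top_of_set Y) U}"
    then obtain C O' where B: "B = {\<xi> \<in> continuous_paths Y. \<xi> ` C \<subseteq> Y \<inter> O'}" "compact C" "open O'"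
      by (auto simp: openin_open)
    \<comment> \<open>The complement of the preimage of \<open>B\<close>; the trajectories stay in \<open>Y\<close>, so only
      \<open>O'\<close> can be left.\<close>
    define E where "E = {x \<in> S. \<exists>c\<in>C. g x c \<notin> O'}"
    have "l \<in> E" if x: "\<And>n. x n \<in> E" and lim: "x \<longlonglongrightarrow> l" for x l
    proof -
      have xS: "\<And>n. x n \<in> S"
        using x by (simp add: E_def)
      have l: "l \<in> S"
        by (rule closed_sequentially[OF compact_imp_closed[OF \<open>compact S\<close>] _ lim]) (simp add: xS)
      have "\<forall>n. \<exists>c. c \<in> C \<and> g (x n) c \<notin> O'"
        using x by (auto simp: E_def)
      then obtain c where "\<forall>n. c n \<in> C \<and> g (x n) (c n) \<notin> O'"
        by (rule choice[THEN exE])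
      then have c: "\<And>n. c n \<in> C" "\<And>n. g (x n) (c n) \<notin> O'"
        by simp_all
      have "\<forall>n. c n \<in> C"
        using c(1) by simp
      then obtain c' r where r: "c' \<in> C" "strict_mono r" "(c \<circ> r) \<longlonglongrightarrow> c'"
        by (rule seq_compactE[OF compact_imp_seq_compact[OF B(2)]])
      obtain r' \<xi> where r': "strict_mono r'" and \<xi>: "\<xi> \<in> full_trajectories G"
        and lim\<xi>: "\<And>t. (\<lambda>n. g (x (r (r' n))) t) \<longlonglongrightarrow> \<xi> t"
        by (rule full_trajectory_subsequence[of "\<lambda>n. g (x (r n))", OF g(1)[OF xS]]) (rule that)
      have "(\<lambda>n. e (g (x (r (r' n))))) \<longlonglongrightarrow> e \<xi>"
        by (rule tendsto_fun_componentwise[THEN iffD2]) (use lim\<xi> in \<open>auto simp: e_def\<close>)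
      moreover have "(\<lambda>n. x (r (r' n))) \<longlonglongrightarrow> l"
        using LIMSEQ_subseq_LIMSEQ[OF lim strict_mono_o[OF r(2) r']] by (simp add: o_def)
      ultimately have "e \<xi> = l"
        using LIMSEQ_unique by (simp add: g(2) xS)
      then have "g l = \<xi>"
        using \<xi> by auto
      have "(\<lambda>n. g (x (r (r' n))) (c (r (r' n)))) \<longlonglongrightarrow> \<xi> c'"
        using LIMSEQ_subseq_LIMSEQ[OF r(3) r']
        by (intro pointwise_imp_continuous_convergence[OF g(1)[OF xS] \<xi> lim\<xi>]) (simp add: o_def)
      then have "\<xi> c' \<in> - O'"
        by (rule closed_sequentially[rotated 2]) (use B(3) c(2) in auto)
      then show "l \<in> E"
        using l r(1) \<open>g l = \<xi>\<close> by (auto simp: E_def)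
    qed
    then have "closed E"
      unfolding closed_sequential_limits by blast
    moreover have "g -` B \<inter> topspace (top_of_set S) = S \<inter> - E"
      using g_paths g_Y by (auto simp: B(1) E_def)
    ultimately show "openin (top_of_set S) (g -` B \<inter> topspace (top_of_set S))"
      by (metis openin_open_Int open_Compl)
  next
    show "g ` topspace (top_of_set S) \<subseteq>
      \<Union>{{\<xi> \<in> continuous_paths Y. \<xi> ` C \<subseteq> U} | C U. compact C \<and> openin (top_of_set Y) U}"
      using g_paths topspace_compact_open_topology[of Y]
      unfolding compact_open_topology_def topology_generated_by_topspace by (simp add: image_subset_iff)
  qed
  moreover have "compactin (top_of_set S) S"
    using \<open>compact S\<close> by (simp add: compactin_subtopology)
  ultimately have "compactin (compact_open_topology Y) (g ` S)"
    using image_compactin by blast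
  moreover have "g ` S = full_trajectories G"
    by (force simp: S_def image_image)
  ultimately show ?thesis
    by simp
qed

end

text \<open>
  Local compactness of the line: a compact ball of times around \<open>t\<close> on which \<open>\<xi>\<close> stays in
  \<open>U\<close> provides a subbasic neighbourhood of \<open>\<xi>\<close>.
\<close>

lemma continuous_map_evaluation:
  "continuous_map (prod_topology euclideanreal (compact_open_topology Y)) euclidean (\<lambda>(t, \<xi>). \<xi> t)"
  unfolding continuous_map_def
proof (intro conjI allI impI)
  fix U :: "'a set" assume U: "openin euclidean U"
  let ?P = "prod_topology euclideanreal (compact_open_topology Y)"
  show "openin ?P {p \<in> topspace ?P. (case p of (t, \<xi>) \<Rightarrow> \<xi> t) \<in> U}"
    unfolding openin_prod_topology_alt
  proof (intro allI impI)
    fix t \<xi> assume "(t, \<xi>) \<in> {p \<in> topspace ?P. (case p of (t, \<xi>) \<Rightarrow> \<xi> t) \<in> U}"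
    then have \<xi>: "\<xi> \<in> continuous_paths Y" "\<xi> t \<in> U"
      by auto
    then have "open (\<xi> -` U)"
      using U open_vimage by (auto simp: continuous_paths_def)
    then obtain d where d: "d > 0" "cball t d \<subseteq> \<xi> -` U"
      using \<xi>(2) open_contains_cball by blast
    define B where "B = {\<xi> \<in> continuous_paths Y. \<xi> ` cball t d \<subseteq> Y \<inter> U}"
    have "openin (compact_open_topology Y) B"
      unfolding compact_open_topology_def B_def using U
      by (intro topology_generated_by_Basis CollectI exI[of _ "cball t d"] exI[of _ "Y \<inter> U"])
        (auto simp: openin_open)
    moreover have "\<xi> \<in> B"
      using \<xi>(1) d(2) by (auto simp: B_def continuous_paths_def)
    moreover have "ball t d \<times> B \<subseteq> {p \<in> topspace ?P. (case p of (t, \<xi>) \<Rightarrow> \<xi> t) \<in> U}"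
      by (auto simp: B_def image_subset_iff)
    ultimately show "\<exists>T V. openin euclideanreal T \<and> openin (compact_open_topology Y) V \<and> t \<in> T \<and> \<xi> \<in> V \<and>
        T \<times> V \<subseteq> {p \<in> topspace ?P. (case p of (t, \<xi>) \<Rightarrow> \<xi> t) \<in> U}"
      using d(1) by (intro exI[of _ "ball t d"] exI[of _ B]) auto
  qed
qed auto

text \<open>
  The set in the axiom is the preimage of the closed set \<open>W\<close> under the continuous map
  \<open>(t, \<xi>) \<mapsto> (t, \<xi> t)\<close>, and it is contained in the product of \<open>S\<close> with the compact time
  projection of \<open>W\<close>.
\<close>

lemma compactness_axiom_if_compactin:
  assumes S: "compactin (compact_open_topology Y) S"
  shows "compactness_axiom Y S"
  unfolding compactness_axiom_def
proof (intro allI impI, elim conjE)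
  fix W :: "(real \<times> 'a) set" assume W: "compact W"
  let ?P = "prod_topology euclideanreal (compact_open_topology Y)"
  have "continuous_map ?P euclidean (\<lambda>p. (fst p, case p of (t, \<xi>) \<Rightarrow> \<xi> t))"
    unfolding prod_topology_euclidean[symmetric]
    by (intro continuous_map_pairedI continuous_map_fst continuous_map_evaluation)
  then have "closedin ?P {p \<in> topspace ?P. (fst p, case p of (t, \<xi>) \<Rightarrow> \<xi> t) \<in> W}"
    using W compact_imp_closed by (intro closedin_continuous_map_preimage) auto
  moreover have "compactin ?P (fst ` W \<times> S)"
    using S compact_continuous_image[OF continuous_on_fst[OF continuous_on_id] W]
    by (simp add: compactin_Times)
  ultimately have "compactin ?P ({p \<in> topspace ?P. (fst p, case p of (t, \<xi>) \<Rightarrow> \<xi> t) \<in> W} \<inter> (fst ` W \<times> S))"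
    by (rule closed_Int_compactin)
  also have "{p \<in> topspace ?P. (fst p, case p of (t, \<xi>) \<Rightarrow> \<xi> t) \<in> W} \<inter> (fst ` W \<times> S) =
      {(t, \<xi>). \<xi> \<in> S \<and> (t, \<xi> t) \<in> W}"
    using compactin_subset_topspace[OF S] by (force simp: image_iff)
  finally show "compactin (prod_topology euclideanreal (subtopology (compact_open_topology Y) S))
      {(t, \<xi>). \<xi> \<in> S \<and> (t, \<xi> t) \<in> W}"
    by (auto simp: prod_topology_subtopology compactin_subtopology)
qed

theorem theoremC:
  fixes X :: "'a::metric_space set"
    and G \<K> :: "(real \<Rightarrow> 'a) set"
    and V :: "real \<Rightarrow> 'a set \<Rightarrow> 'a set"
  assumes "compact X" and "X \<noteq> {}"
    and "generalized_semiflow X G"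
    and "\<And>\<phi>. \<phi> \<in> G \<Longrightarrow> continuous_on {0..} \<phi>"
  defines "V \<equiv> multivalued_semigroup G"
    and "\<K> \<equiv> continuous_complete_trajectories X V"
  shows "\<K> \<noteq> {} \<and> shift_invariant \<K> \<and>
    \<K> \<subseteq> continuous_paths (time_zero ` \<K>) \<and>
    existence_axiom (time_zero ` \<K>) \<K> \<and>
    compactness_axiom (time_zero ` \<K>) \<K> \<and>
    switching_axiom \<K>"
proof -
  interpret compact_continuous_semiflow X G
    using assms(1,3,4) by (simp add: compact_continuous_semiflow_def compact_continuous_semiflow_axioms_def)
  have \<K>: "\<K> = full_trajectories G"
    unfolding \<K>_def V_def by (rule continuous_complete_trajectories_eq)
  have invariant: "shift_invariant \<K>"
    unfolding shift_invariant_def \<K> using shift_full_trajectory by blast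
  have "\<xi> t \<in> time_zero ` \<K>" if "\<xi> \<in> \<K>" for \<xi> t
    using invariant that
    by (auto simp: shift_invariant_def time_zero_def shift_def intro!: rev_image_eqI[of "shift t \<xi>"])
  then have paths: "\<K> \<subseteq> continuous_paths (time_zero ` \<K>)"
    using full_trajectory_continuous by (auto simp: continuous_paths_def \<K>)
  have "compactness_axiom (time_zero ` \<K>) \<K>"
    using compactness_axiom_if_compactin compactin_full_trajectories paths unfolding \<K> by blast
  moreover have "existence_axiom (time_zero ` \<K>) \<K>"
    by (auto simp: existence_axiom_def time_zero_def)
  ultimately show ?thesis
    using full_trajectories_nonempty[OF \<open>X \<noteq> {}\<close>] invariant paths full_trajectories_switching
    by (simp add: \<K>)
qed

end
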